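(* Let $l,n\ge1$, $\sigma>0$ and $\mu^1,\dots,\mu^l\in\mathbb{R}^3$. For each $k=1,\dots,l$ let $X^k_1,\dots,X^k_n$ be independent Gaussian random vectors with mean $\mu^k$ and independent coordinates of standard deviation $\sigma$, regarded as points of $\mathbb{R}^3/\mathbb{R}{\bf 1}$, and let $\hat\mu^k=\frac1n\sum_{i=1}^nX^k_i$ be the estimated center of the $k$-th Gaussian. Let $X^k_{i,\mathrm{proj}}$ be the projection of $X^k_i$ to a tropical polynomial curve that passes through all the estimated centers $\hat\mu^1,\dots,\hat\mu^l$. Then for all $i=1,\dots,n$ and $k=1,\dots,l$, $$\mathbb{E}\big[d_{\rm tr}(X^k_i,X^k_{i,\mathrm{proj}})\big]\le\sqrt{\frac{n-1}{n}}\;2\sigma\sqrt{2\log(3)}.$$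
   Context: ${\bf 1}=(1,1,1)$. Tropical distance on $\mathbb{R}^3/\mathbb{R}{\bf 1}$: $d_{\rm tr}(v,w)=\max_i(v_i-w_i)-\min_i(v_i-w_i)$. Identify $\mathbb{R}^3/\mathbb{R}{\bf 1}$ with the plane of points $(x,y,0)$. A tropical polynomial in $x,y$ is a maximum of finitely many expressions $c_{ab}+ax+by$ (monomials $c_{ab}\odot x^a\odot y^b$ in max-plus arithmetic; e.g. the $x$-quadratic $\max\{\omega_{xx}+2x,\ \omega_x+x,\ \omega_y+y,\ 0\}$), and its tropical polynomial curve is the set of points where this maximum is attained at least twice. The projection of a point to the curve is a point of the curve at minimal tropical distance from it. The curve depends on the sample and is assumed to contain all $\hat\mu^k$. *)

theory Defs
  imports "HOL-Probability.Probability"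
begin

text \<open>Points of \<open>\<real>\<^sup>3 / \<real>(1,1,1)\<close> are handled through representatives in \<open>real ^ 3\<close>;
  \<open>plane_rep\<close> picks the representative of the form \<open>(x, y, 0)\<close>.\<close>

definition plane_rep :: "real ^ 3 \<Rightarrow> real ^ 3" where
  "plane_rep v = (\<chi> j. v $ j - v $ 3)"

definition d_tr :: "real ^ 3 \<Rightarrow> real ^ 3 \<Rightarrow> real" where
  "d_tr v w = Max (range (\<lambda>j. v $ j - w $ j)) - Min (range (\<lambda>j. v $ j - w $ j))"

lemma d_tr_eq: "d_tr v w =
    max (v $ 1 - w $ 1) (max (v $ 2 - w $ 2) (v $ 3 - w $ 3)) -
    min (v $ 1 - w $ 1) (min (v $ 2 - w $ 2) (v $ 3 - w $ 3))"
  by (simp add: d_tr_def UNIV_3)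

text \<open>The distance does not depend on the choice of representatives, so its arguments need
  not be normalized by \<open>plane_rep\<close>.\<close>

lemma d_tr_translate: "d_tr (v + a *\<^sub>R 1) (w + b *\<^sub>R 1) = d_tr v w"
  by (simp add: d_tr_eq max_def min_def)

lemma d_tr_plane_rep: "d_tr (plane_rep v) (plane_rep w) = d_tr v w"
  by (simp add: plane_rep_def d_tr_eq max_def min_def)

text \<open>A tropical polynomial is given by a finite nonempty set \<open>S\<close> of exponent pairs and
  coefficients \<open>c\<close>, of which only those on \<open>S\<close> matter.\<close>

definition trop_monom :: "(nat \<times> nat \<Rightarrow> real) \<Rightarrow> nat \<times> nat \<Rightarrow> real ^ 3 \<Rightarrow> real" where
  "trop_monom c m v = c m + real (fst m) * v $ 1 + real (snd m) * v $ 2"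

definition trop_poly :: "(nat \<times> nat) set \<Rightarrow> (nat \<times> nat \<Rightarrow> real) \<Rightarrow> real ^ 3 \<Rightarrow> real" where
  "trop_poly S c v = Max ((\<lambda>m. trop_monom c m v) ` S)"

definition trop_curve :: "(nat \<times> nat) set \<Rightarrow> (nat \<times> nat \<Rightarrow> real) \<Rightarrow> (real ^ 3) set" where
  "trop_curve S c =
     {v. v $ 3 = 0 \<and> card {m \<in> S. trop_monom c m v = trop_poly S c v} \<ge> 2}"

definition is_trop_curve :: "(real ^ 3) set \<Rightarrow> bool" where
  "is_trop_curve C \<longleftrightarrow> (\<exists>S c. finite S \<and> S \<noteq> {} \<and> C = trop_curve S c)"

definition is_trop_projection :: "(real ^ 3) set \<Rightarrow> real ^ 3 \<Rightarrow> real ^ 3 \<Rightarrow> bool" where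
  "is_trop_projection C v p \<longleftrightarrow> p \<in> C \<and> (\<forall>q\<in>C. d_tr v p \<le> d_tr v q)"

definition gaussian_vector ::
    "'a measure \<Rightarrow> real ^ 3 \<Rightarrow> real \<Rightarrow> ('a \<Rightarrow> real ^ 3) \<Rightarrow> bool" where
  "gaussian_vector M m s Y \<longleftrightarrow>
     prob_space.indep_vars M (\<lambda>_. borel) (\<lambda>j \<omega>. Y \<omega> $ j) UNIV \<and>
     (\<forall>j. distributed M lborel (\<lambda>\<omega>. Y \<omega> $ j) (\<lambda>x. ennreal (normal_density (m $ j) s x)))"

definition sample_mean :: "nat \<Rightarrow> (nat \<Rightarrow> 'a \<Rightarrow> real ^ 3) \<Rightarrow> 'a \<Rightarrow> real ^ 3" where
  "sample_mean n Y \<omega> = (1 / real n) *\<^sub>R (\<Sum>i = 1..n. Y i \<omega>)"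

end

theory Submission imports Defs begin

text \<open>A projection is a nearest point of the curve and the curve contains the estimated center,
  so a sample point is at most as far from its projection as from its estimated center. The
  difference \<open>Z\<close> of sample point and estimated center is the linear combination of the sample
  with weights \<open>1 - 1/n\<close> at the point itself and \<open>-1/n\<close> elsewhere. These weights sum to \<open>0\<close>,
  which removes the mean, and their squares sum to \<open>(n-1)/n\<close>, so by the independence of the
  sample points each coordinate of \<open>Z\<close> is centered Gaussian of standard deviation
  \<open>\<tau> = \<sigma> * sqrt ((n-1)/n)\<close> (\<open>sub_gaussian_sample_deviation\<close>). The tropical distance is the
  maximum of the three coordinates of \<open>Z\<close> plus the maximum of the three coordinates of \<open>- Z\<close>,
  and each of these two maxima has expectation at most \<open>\<tau> * sqrt (2 * ln 3)\<close> by the maximal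
  inequality for sub-Gaussian variables (\<open>expectation_Max_sub_gaussian_le\<close>).

  For \<open>n = 1\<close> the difference \<open>Z\<close> is constantly \<open>0\<close> and has no density. Gaussianity of \<open>Z\<close> is
  therefore expressed by a bound on the moment generating function, which is all that the
  maximal inequality asks for.\<close>

section \<open>Sub-Gaussian random variables\<close>

definition sub_gaussian :: "'a measure \<Rightarrow> real \<Rightarrow> ('a \<Rightarrow> real) \<Rightarrow> bool" where
  "sub_gaussian M \<tau> Y \<longleftrightarrow> Y \<in> borel_measurable M \<and>
     (\<forall>t. integrable M (\<lambda>\<omega>. exp (t * Y \<omega>)) \<and>
          (\<integral>\<omega>. exp (t * Y \<omega>) \<partial>M) \<le> exp (t\<^sup>2 * \<tau>\<^sup>2 / 2))"

lemma sub_gaussian_uminus: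
  assumes "sub_gaussian M \<tau> Y"
  shows "sub_gaussian M \<tau> (\<lambda>\<omega>. - Y \<omega>)"
  unfolding sub_gaussian_def
proof (intro conjI allI)
  show "(\<lambda>\<omega>. - Y \<omega>) \<in> borel_measurable M"
    using assms by (simp add: sub_gaussian_def)
  fix t
  have "integrable M (\<lambda>\<omega>. exp ((- t) * Y \<omega>)) \<and>
      (\<integral>\<omega>. exp ((- t) * Y \<omega>) \<partial>M) \<le> exp ((- t)\<^sup>2 * \<tau>\<^sup>2 / 2)"
    using assms unfolding sub_gaussian_def by blast
  then show "integrable M (\<lambda>\<omega>. exp (t * - Y \<omega>))"
    and "(\<integral>\<omega>. exp (t * - Y \<omega>) \<partial>M) \<le> exp (t\<^sup>2 * \<tau>\<^sup>2 / 2)"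
    by simp_all
qed

lemma sub_gaussian_mono:
  assumes "sub_gaussian M \<tau> Y" and "0 \<le> \<tau>" and "\<tau> \<le> \<tau>'"
  shows "sub_gaussian M \<tau>' Y"
proof -
  have "exp (t\<^sup>2 * \<tau>\<^sup>2 / 2) \<le> exp (t\<^sup>2 * \<tau>'\<^sup>2 / 2)" for t
    using assms by (simp add: power_mono mult_left_mono)
  then show ?thesis
    using assms(1) unfolding sub_gaussian_def by (meson order_trans)
qed

text \<open>The exponential moments at \<open>1\<close> and \<open>-1\<close> dominate the absolute value.\<close>

lemma integrable_sub_gaussian:
  assumes "sub_gaussian M \<tau> Y"
  shows "integrable M Y"
proof (rule Bochner_Integration.integrable_bound)
  have "integrable M (\<lambda>\<omega>. exp (1 * Y \<omega>))" "integrable M (\<lambda>\<omega>. exp ((-1) * Y \<omega>))"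
    using assms unfolding sub_gaussian_def by blast+
  then show "integrable M (\<lambda>\<omega>. exp (Y \<omega>) + exp (- Y \<omega>))"
    by simp
  show "Y \<in> borel_measurable M"
    using assms by (simp add: sub_gaussian_def)
  have "\<bar>y\<bar> \<le> exp y + exp (- y)" for y :: real
    using exp_ge_add_one_self[of y] exp_ge_add_one_self[of "- y"] exp_gt_zero[of y]
      exp_gt_zero[of "- y"] by linarith
  then show "AE \<omega> in M. norm (Y \<omega>) \<le> norm (exp (Y \<omega>) + exp (- Y \<omega>))"
    by (simp add: order_trans[OF _ abs_ge_self])
qed

lemma integrable_Max:
  fixes Y :: "'i \<Rightarrow> 'a \<Rightarrow> real"
  assumes "finite I" and "I \<noteq> {}" and "\<And>i. i \<in> I \<Longrightarrow> integrable M (Y i)"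
  shows "integrable M (\<lambda>\<omega>. Max ((\<lambda>i. Y i \<omega>) ` I))"
  using assms
proof (induction I rule: finite_ne_induct)
  case (insert i I)
  have "integrable M (\<lambda>\<omega>. max (Y i \<omega>) (Max ((\<lambda>i. Y i \<omega>) ` I)))"
    using insert by (intro integrable_max) auto
  then show ?case
    using insert by simp
qed simp

text \<open>For \<open>t > 0\<close> the tangent inequality \<open>1 + u \<le> exp u\<close> at \<open>u = t * y - ln a\<close> reads
  \<open>t * y \<le> ln a - 1 + exp (t * y) / a\<close>. Enlarging the right-hand side to the sum of all
  exponentials bounds \<open>t\<close> times the maximum by something whose expectation is known. This is
  Jensen's inequality for \<open>ln\<close> with the tangent point \<open>a\<close> left free; it is best to take for \<open>a\<close>
  the bound \<open>card I * exp (t\<^sup>2 * \<tau>\<^sup>2 / 2)\<close> on the expected sum, and then to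
  minimize \<open>ln (card I) / t + t * \<tau>\<^sup>2 / 2\<close> over \<open>t\<close>.\<close>

lemma expectation_Max_sub_gaussian_le_pos:
  fixes Y :: "'i \<Rightarrow> 'a \<Rightarrow> real"
  assumes "prob_space M" and I: "finite I" "card I \<ge> 2" and "\<tau> > 0"
    and Y: "\<And>i. i \<in> I \<Longrightarrow> sub_gaussian M \<tau> (Y i)"
  shows "(\<integral>\<omega>. Max ((\<lambda>i. Y i \<omega>) ` I) \<partial>M) \<le> \<tau> * sqrt (2 * ln (card I))"
proof -
  interpret prob_space M by fact
  define N where "N = real (card I)"
  define s where "s = sqrt (2 * ln N)"
  \<comment> \<open>the minimizer of \<open>ln N / t + t * \<tau>\<^sup>2 / 2\<close>\<close>
  define t where "t = s / \<tau>"
  define a where "a = N * exp (t\<^sup>2 * \<tau>\<^sup>2 / 2)"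
  have N: "N \<ge> 2" and "I \<noteq> {}"
    using I by (auto simp: N_def)
  have s: "s > 0" "s\<^sup>2 = 2 * ln N"
    using N by (auto simp: s_def)
  then have t: "t > 0" "t\<^sup>2 * \<tau>\<^sup>2 = 2 * ln N"
    using \<open>\<tau> > 0\<close> by (auto simp: t_def power_divide)
  have a: "a > 0" "ln a = 2 * ln N"
    using N t by (auto simp: a_def ln_mult)
  have expY: "integrable M (\<lambda>\<omega>. exp (t * Y i \<omega>))"
      "(\<integral>\<omega>. exp (t * Y i \<omega>) \<partial>M) \<le> exp (t\<^sup>2 * \<tau>\<^sup>2 / 2)" if "i \<in> I" for i
    using Y[OF that] unfolding sub_gaussian_def by blast+
  let ?b = "\<lambda>\<omega>. ln a - 1 + (\<Sum>i\<in>I. exp (t * Y i \<omega>)) / a"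
  have int: "integrable M (\<lambda>\<omega>. \<Sum>i\<in>I. exp (t * Y i \<omega>))"
    using expY by auto
  have bound: "t * Max ((\<lambda>i. Y i \<omega>) ` I) \<le> ?b \<omega>" for \<omega>
  proof -
    have "Max ((\<lambda>i. Y i \<omega>) ` I) \<in> (\<lambda>i. Y i \<omega>) ` I"
      using I(1) \<open>I \<noteq> {}\<close> by simp
    then obtain i where i: "i \<in> I" "Max ((\<lambda>i. Y i \<omega>) ` I) = Y i \<omega>"
      by auto
    have "t * Y i \<omega> \<le> ln a - 1 + exp (t * Y i \<omega> - ln a)"
      using exp_ge_add_one_self[of "t * Y i \<omega> - ln a"] by linarith
    also have "exp (t * Y i \<omega> - ln a) = exp (t * Y i \<omega>) / a"
      using a(1) by (simp add: exp_diff)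
    also have "\<dots> \<le> (\<Sum>i\<in>I. exp (t * Y i \<omega>)) / a"
      using a(1) I(1) i(1)
      by (intro divide_right_mono member_le_sum) auto
    finally show ?thesis
      using i(2) by simp
  qed
  have intMax: "integrable M (\<lambda>\<omega>. Max ((\<lambda>i. Y i \<omega>) ` I))"
    using I(1) \<open>I \<noteq> {}\<close> Y by (intro integrable_Max integrable_sub_gaussian)
  have "t * (\<integral>\<omega>. Max ((\<lambda>i. Y i \<omega>) ` I) \<partial>M) = (\<integral>\<omega>. t * Max ((\<lambda>i. Y i \<omega>) ` I) \<partial>M)"
    by simp
  also have "\<dots> \<le> (\<integral>\<omega>. ?b \<omega> \<partial>M)"
    using intMax int bound by (intro integral_mono) auto
  also have "\<dots> = ln a - 1 + (\<Sum>i\<in>I. \<integral>\<omega>. exp (t * Y i \<omega>) \<partial>M) / a"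
    using int expY by (simp add: prob_space)
  also have "(\<Sum>i\<in>I. \<integral>\<omega>. exp (t * Y i \<omega>) \<partial>M) \<le> a"
    using sum_bounded_above[of I "\<lambda>i. \<integral>\<omega>. exp (t * Y i \<omega>) \<partial>M"] expY(2)
    by (simp add: a_def N_def)
  finally have "t * (\<integral>\<omega>. Max ((\<lambda>i. Y i \<omega>) ` I) \<partial>M) \<le> s\<^sup>2"
    using a s(2) by (simp add: divide_right_mono)
  also have "s\<^sup>2 = t * (\<tau> * s)"
    using \<open>\<tau> > 0\<close> by (simp add: t_def power2_eq_square)
  finally show ?thesis
    using t(1) by (simp add: s_def N_def)
qed

text \<open>The case \<open>\<tau> = 0\<close>, in which the optimal \<open>t\<close> is infinite, is a limit of the others.\<close>

lemma expectation_Max_sub_gaussian_le: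
  fixes Y :: "'i \<Rightarrow> 'a \<Rightarrow> real"
  assumes "prob_space M" and I: "finite I" "card I \<ge> 2" and "\<tau> \<ge> 0"
    and Y: "\<And>i. i \<in> I \<Longrightarrow> sub_gaussian M \<tau> (Y i)"
  shows "(\<integral>\<omega>. Max ((\<lambda>i. Y i \<omega>) ` I) \<partial>M) \<le> \<tau> * sqrt (2 * ln (card I))"
proof -
  define s where "s = sqrt (2 * ln (card I))"
  have s: "s > 0"
    using I by (simp add: s_def)
  have "(\<integral>\<omega>. Max ((\<lambda>i. Y i \<omega>) ` I) \<partial>M) / s \<le> \<tau>"
  proof (rule dense_ge)
    fix \<tau>' assume "\<tau> < \<tau>'"
    then have "sub_gaussian M \<tau>' (Y i)" if "i \<in> I" for i
      using sub_gaussian_mono[OF Y[OF that] \<open>\<tau> \<ge> 0\<close>] by simp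
    then have "(\<integral>\<omega>. Max ((\<lambda>i. Y i \<omega>) ` I) \<partial>M) \<le> \<tau>' * s"
      unfolding s_def using \<open>\<tau> \<ge> 0\<close> \<open>\<tau> < \<tau>'\<close>
      by (intro expectation_Max_sub_gaussian_le_pos[OF \<open>prob_space M\<close> I]) auto
    then show "(\<integral>\<omega>. Max ((\<lambda>i. Y i \<omega>) ` I) \<partial>M) / s \<le> \<tau>'"
      using s by (simp add: divide_le_eq)
  qed
  then show ?thesis
    using s by (simp add: divide_le_eq s_def)
qed

section \<open>Linear combinations of independent normal variables\<close>

text \<open>Completing the square turns an exponentially tilted normal density into a multiple of
  the normal density with mean shifted by \<open>t * \<sigma>\<^sup>2\<close>, whose integral is \<open>1\<close>.\<close>

lemma normal_moment_generating_function:
  assumes "prob_space M" and "\<sigma> > 0"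
    and Y: "distributed M lborel Y (\<lambda>x. ennreal (normal_density m \<sigma> x))"
  shows "integrable M (\<lambda>\<omega>. exp (t * Y \<omega>))"
    and "(\<integral>\<omega>. exp (t * Y \<omega>) \<partial>M) = exp (t * m + t\<^sup>2 * \<sigma>\<^sup>2 / 2)"
proof -
  have tilt: "normal_density m \<sigma> x * exp (t * x) =
      exp (t * m + t\<^sup>2 * \<sigma>\<^sup>2 / 2) * normal_density (m + t * \<sigma>\<^sup>2) \<sigma> x" for x
  proof -
    have "- (x - m)\<^sup>2 / (2 * \<sigma>\<^sup>2) + t * x =
        (t * m + t\<^sup>2 * \<sigma>\<^sup>2 / 2) + - (x - (m + t * \<sigma>\<^sup>2))\<^sup>2 / (2 * \<sigma>\<^sup>2)"
      using \<open>\<sigma> > 0\<close> by (simp add: field_simps power2_eq_square)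
    then have "exp (- (x - m)\<^sup>2 / (2 * \<sigma>\<^sup>2)) * exp (t * x) =
        exp (t * m + t\<^sup>2 * \<sigma>\<^sup>2 / 2) * exp (- (x - (m + t * \<sigma>\<^sup>2))\<^sup>2 / (2 * \<sigma>\<^sup>2))"
      by (metis exp_add)
    then show ?thesis
      by (simp add: normal_density_def)
  qed
  have "integrable lborel (\<lambda>x. normal_density m \<sigma> x * exp (t * x))"
    unfolding tilt using \<open>\<sigma> > 0\<close> by simp
  then show "integrable M (\<lambda>\<omega>. exp (t * Y \<omega>))"
    using distributed_integrable[OF Y, of "\<lambda>x. exp (t * x)"] by simp
  have "(\<integral>\<omega>. exp (t * Y \<omega>) \<partial>M) = (\<integral>x. normal_density m \<sigma> x * exp (t * x) \<partial>lborel)"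
    using distributed_integral[OF Y, of "\<lambda>x. exp (t * x)"] by simp
  then show "(\<integral>\<omega>. exp (t * Y \<omega>) \<partial>M) = exp (t * m + t\<^sup>2 * \<sigma>\<^sup>2 / 2)"
    unfolding tilt using \<open>\<sigma> > 0\<close> by simp
qed

text \<open>By independence the moment generating function is a product of those of the normal
  summands. The means contribute \<open>t * m * (\<Sum>i\<in>I. c i)\<close> to the exponent, which is why the weights
  have to sum to \<open>0\<close>.\<close>

lemma sub_gaussian_centered_combination:
  fixes Y :: "'i \<Rightarrow> 'a \<Rightarrow> real"
  assumes "prob_space M" and "finite I" and "\<sigma> > 0"
    and indep: "prob_space.indep_vars M (\<lambda>_. borel) Y I"
    and normal: "\<And>i. i \<in> I \<Longrightarrow> distributed M lborel (Y i) (\<lambda>x. ennreal (normal_density m \<sigma> x))"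
    and centered: "(\<Sum>i\<in>I. c i) = 0"
  shows "sub_gaussian M (\<sigma> * sqrt (\<Sum>i\<in>I. (c i)\<^sup>2)) (\<lambda>\<omega>. \<Sum>i\<in>I. c i * Y i \<omega>)"
  unfolding sub_gaussian_def
proof (intro conjI allI)
  interpret prob_space M by fact
  have Y: "Y i \<in> borel_measurable M" if "i \<in> I" for i
    using indep that unfolding indep_vars_def by auto
  then show "(\<lambda>\<omega>. \<Sum>i\<in>I. c i * Y i \<omega>) \<in> borel_measurable M"
    by measurable
  fix t
  have prod: "exp (t * (\<Sum>i\<in>I. c i * Y i \<omega>)) = (\<Prod>i\<in>I. exp ((t * c i) * Y i \<omega>))" for \<omega>
    using \<open>finite I\<close> by (simp add: sum_distrib_left exp_sum mult.assoc)
  have indep_exp: "indep_vars (\<lambda>_. borel) (\<lambda>i \<omega>. exp ((t * c i) * Y i \<omega>)) I"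
    using indep by (rule indep_vars_compose2) simp
  note mgf = normal_moment_generating_function[OF \<open>prob_space M\<close> \<open>\<sigma> > 0\<close> normal]
  show "integrable M (\<lambda>\<omega>. exp (t * (\<Sum>i\<in>I. c i * Y i \<omega>)))"
    unfolding prod using mgf(1) by (intro indep_vars_integrable[OF \<open>finite I\<close> indep_exp])
  have "(\<integral>\<omega>. exp (t * (\<Sum>i\<in>I. c i * Y i \<omega>)) \<partial>M) =
      (\<Prod>i\<in>I. \<integral>\<omega>. exp ((t * c i) * Y i \<omega>) \<partial>M)"
    unfolding prod using mgf(1)
    by (intro indep_vars_lebesgue_integral[OF \<open>finite I\<close> indep_exp])
  also have "\<dots> = (\<Prod>i\<in>I. exp ((t * c i) * m + (t * c i)\<^sup>2 * \<sigma>\<^sup>2 / 2))"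
    using mgf(2) by (intro prod.cong) auto
  also have "\<dots> = exp (\<Sum>i\<in>I. (t * c i) * m + (t * c i)\<^sup>2 * \<sigma>\<^sup>2 / 2)"
    using \<open>finite I\<close> by (simp add: exp_sum)
  also have "(\<Sum>i\<in>I. (t * c i) * m + (t * c i)\<^sup>2 * \<sigma>\<^sup>2 / 2) =
      (t * m) * (\<Sum>i\<in>I. c i) + t\<^sup>2 * \<sigma>\<^sup>2 / 2 * (\<Sum>i\<in>I. (c i)\<^sup>2)"
    by (simp add: sum.distrib sum_distrib_left power_mult_distrib mult_ac)
  also have "\<dots> = t\<^sup>2 * (\<sigma> * sqrt (\<Sum>i\<in>I. (c i)\<^sup>2))\<^sup>2 / 2"
    by (simp add: centered power_mult_distrib sum_nonneg)
  finally show "(\<integral>\<omega>. exp (t * (\<Sum>i\<in>I. c i * Y i \<omega>)) \<partial>M) \<le>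
      exp (t\<^sup>2 * (\<sigma> * sqrt (\<Sum>i\<in>I. (c i)\<^sup>2))\<^sup>2 / 2)"
    by simp
qed

section \<open>Deviation of a Gaussian sample from its mean\<close>

lemma sum_sample_deviation_weights:
  assumes "i \<in> {1..n}"
  shows "(\<Sum>m=1..n. (if m = i then 1 else 0) - 1 / real n) = 0"
    and "(\<Sum>m=1..n. ((if m = i then 1 else 0) - 1 / real n)\<^sup>2) = (real n - 1) / real n"
proof -
  have n: "real n > 0"
    using assms by simp
  show "(\<Sum>m=1..n. (if m = i then 1 else 0) - 1 / real n) = 0"
    using assms n by (simp add: sum_subtractf)
  have "((if m = i then 1 else 0) - 1 / real n)\<^sup>2 =
      (if m = i then 1 - 2 / real n else 0) + 1 / (real n)\<^sup>2" for m
    by (simp add: power2_diff power_divide)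
  then have "(\<Sum>m=1..n. ((if m = i then 1 else 0) - 1 / real n)\<^sup>2) =
      (1 - 2 / real n) + real n * (1 / (real n)\<^sup>2)"
    using assms by (simp add: sum.distrib)
  also have "\<dots> = (real n - 1) / real n"
    using n by (simp add: field_simps power2_eq_square)
  finally show "(\<Sum>m=1..n. ((if m = i then 1 else 0) - 1 / real n)\<^sup>2) = (real n - 1) / real n" .
qed

lemma sub_gaussian_sample_deviation:
  fixes Y :: "nat \<Rightarrow> 'a \<Rightarrow> real ^ 3"
  assumes "prob_space M" and "\<sigma> > 0" and i: "i \<in> {1..n}"
    and gaussian: "\<And>m. m \<in> {1..n} \<Longrightarrow> gaussian_vector M \<mu> \<sigma> (Y m)"
    and indep: "prob_space.indep_vars M (\<lambda>_. borel) Y {1..n}"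
  shows "sub_gaussian M (\<sigma> * sqrt ((real n - 1) / real n))
    (\<lambda>\<omega>. Y i \<omega> $ j - sample_mean n Y \<omega> $ j)"
proof -
  interpret prob_space M by fact
  define c where "c m = (if m = i then 1 else 0) - 1 / real n" for m
  have "indep_vars (\<lambda>_. borel) (\<lambda>m \<omega>. Y m \<omega> $ j) {1..n}"
    using indep by (rule indep_vars_compose2) simp
  moreover have "distributed M lborel (\<lambda>\<omega>. Y m \<omega> $ j)
      (\<lambda>x. ennreal (normal_density (\<mu> $ j) \<sigma> x))" if "m \<in> {1..n}" for m
    using gaussian[OF that] by (simp add: gaussian_vector_def)
  moreover have "(\<Sum>m=1..n. c m) = 0" "(\<Sum>m=1..n. (c m)\<^sup>2) = (real n - 1) / real n"
    using sum_sample_deviation_weights[OF i] by (simp_all add: c_def)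
  ultimately have "sub_gaussian M (\<sigma> * sqrt ((real n - 1) / real n))
      (\<lambda>\<omega>. \<Sum>m=1..n. c m * Y m \<omega> $ j)"
    using sub_gaussian_centered_combination[of M "{1..n}" \<sigma> "\<lambda>m \<omega>. Y m \<omega> $ j" "\<mu> $ j" c]
      \<open>prob_space M\<close> \<open>\<sigma> > 0\<close> by simp
  moreover have "(\<Sum>m=1..n. c m * Y m \<omega> $ j) = Y i \<omega> $ j - sample_mean n Y \<omega> $ j" for \<omega>
  proof -
    have "c m * Y m \<omega> $ j = (if m = i then Y m \<omega> $ j else 0) - 1 / real n * Y m \<omega> $ j" for m
      by (simp add: c_def algebra_simps)
    then show ?thesis
      using i by (simp add: sum_subtractf sample_mean_def
          flip: sum_divide_distrib)
  qed
  ultimately show ?thesis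
    by simp
qed

lemma d_tr_eq_Max_plus_Max:
  "d_tr v w = Max (range (\<lambda>j. v $ j - w $ j)) + Max (range (\<lambda>j. - (v $ j - w $ j)))"
proof -
  have "a - min b (min c d) = a + max (- b) (max (- c) (- d))" for a b c d :: real
    by linarith
  then show ?thesis
    unfolding d_tr_eq by (simp add: UNIV_3)
qed

lemma d_tr_plane_rep_right: "d_tr v (plane_rep w) = d_tr v w"
proof -
  have "plane_rep w = w + (- w $ 3) *\<^sub>R 1"
    by (simp add: plane_rep_def vec_eq_iff)
  then show ?thesis
    using d_tr_translate[of v 0 w "- w $ 3"] by simp
qed

lemma d_tr_nonneg: "d_tr v w \<ge> 0"
  by (simp add: d_tr_eq min_le_iff_disj le_max_iff_disj)

lemma expectation_d_tr_sample_mean_le: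
  fixes Y :: "nat \<Rightarrow> 'a \<Rightarrow> real ^ 3"
  assumes "prob_space M" and "\<sigma> > 0" and i: "i \<in> {1..n}"
    and gaussian: "\<And>m. m \<in> {1..n} \<Longrightarrow> gaussian_vector M \<mu> \<sigma> (Y m)"
    and indep: "prob_space.indep_vars M (\<lambda>_. borel) Y {1..n}"
  shows "integrable M (\<lambda>\<omega>. d_tr (Y i \<omega>) (sample_mean n Y \<omega>))"
    and "(\<integral>\<omega>. d_tr (Y i \<omega>) (sample_mean n Y \<omega>) \<partial>M)
      \<le> sqrt ((real n - 1) / real n) * (2 * \<sigma> * sqrt (2 * ln 3))"
proof -
  define \<tau> where "\<tau> = \<sigma> * sqrt ((real n - 1) / real n)"
  define Z where "Z j \<omega> = Y i \<omega> $ j - sample_mean n Y \<omega> $ j" for j \<omega>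
  have \<tau>: "\<tau> \<ge> 0"
    using \<open>\<sigma> > 0\<close> i by (simp add: \<tau>_def)
  have Z: "sub_gaussian M \<tau> (\<lambda>\<omega>. Z j \<omega>)" for j
    unfolding \<tau>_def Z_def using assms by (rule sub_gaussian_sample_deviation)
  have int: "integrable M (\<lambda>\<omega>. Max (range (\<lambda>j. Z j \<omega>)))"
      "integrable M (\<lambda>\<omega>. Max (range (\<lambda>j. - Z j \<omega>)))"
    using integrable_sub_gaussian[OF Z] by (auto intro!: integrable_Max)
  have d: "d_tr (Y i \<omega>) (sample_mean n Y \<omega>) =
      Max (range (\<lambda>j. Z j \<omega>)) + Max (range (\<lambda>j. - Z j \<omega>))" for \<omega>
    by (simp only: d_tr_eq_Max_plus_Max Z_def)
  show "integrable M (\<lambda>\<omega>. d_tr (Y i \<omega>) (sample_mean n Y \<omega>))"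
    unfolding d using int by simp
  have "(\<integral>\<omega>. Max (range (\<lambda>j. Z j \<omega>)) \<partial>M) \<le> \<tau> * sqrt (2 * ln 3)"
    using expectation_Max_sub_gaussian_le[OF \<open>prob_space M\<close>, of "UNIV :: 3 set" \<tau> Z] \<tau> Z
    by simp
  moreover have "(\<integral>\<omega>. Max (range (\<lambda>j. - Z j \<omega>)) \<partial>M) \<le> \<tau> * sqrt (2 * ln 3)"
    using expectation_Max_sub_gaussian_le[OF \<open>prob_space M\<close>, of "UNIV :: 3 set" \<tau> "\<lambda>j \<omega>. - Z j \<omega>"]
      \<tau> sub_gaussian_uminus[OF Z] by simp
  ultimately have "(\<integral>\<omega>. d_tr (Y i \<omega>) (sample_mean n Y \<omega>) \<partial>M) \<le> 2 * (\<tau> * sqrt (2 * ln 3))"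
    unfolding d using int by simp
  then show "(\<integral>\<omega>. d_tr (Y i \<omega>) (sample_mean n Y \<omega>) \<partial>M)
      \<le> sqrt ((real n - 1) / real n) * (2 * \<sigma> * sqrt (2 * ln 3))"
    by (simp add: \<tau>_def mult_ac)
qed

section \<open>Distance to the projection\<close>


theorem theorem27:
  fixes M :: "'a measure"
    and l n :: nat
    and \<sigma> :: real
    and \<mu> :: "nat \<Rightarrow> real ^ 3"
    and X Xproj :: "nat \<Rightarrow> nat \<Rightarrow> 'a \<Rightarrow> real ^ 3"
    and curve :: "'a \<Rightarrow> (real ^ 3) set"
  assumes "prob_space M"
    and "l \<ge> 1" and "n \<ge> 1" and "\<sigma> > 0"
    and gaussian: "\<And>k i. k \<in> {1..l} \<Longrightarrow> i \<in> {1..n} \<Longrightarrow> gaussian_vector M (\<mu> k) \<sigma> (X k i)"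
    and indep: "\<And>k. k \<in> {1..l} \<Longrightarrow> prob_space.indep_vars M (\<lambda>_. borel) (X k) {1..n}"
    and curve: "AE \<omega> in M. is_trop_curve (curve \<omega>)"
    and through: "AE \<omega> in M. \<forall>k\<in>{1..l}. plane_rep (sample_mean n (X k) \<omega>) \<in> curve \<omega>"
    and proj: "AE \<omega> in M. \<forall>k\<in>{1..l}. \<forall>i\<in>{1..n}.
                 is_trop_projection (curve \<omega>) (X k i \<omega>) (Xproj k i \<omega>)"
    and meas: "\<And>k i. k \<in> {1..l} \<Longrightarrow> i \<in> {1..n} \<Longrightarrow>
                 (\<lambda>\<omega>. d_tr (X k i \<omega>) (Xproj k i \<omega>)) \<in> borel_measurable M"
  shows "\<forall>i\<in>{1..n}. \<forall>k\<in>{1..l}.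
           integrable M (\<lambda>\<omega>. d_tr (X k i \<omega>) (Xproj k i \<omega>)) \<and>
           prob_space.expectation M (\<lambda>\<omega>. d_tr (X k i \<omega>) (Xproj k i \<omega>))
             \<le> sqrt ((real n - 1) / real n) * (2 * \<sigma> * sqrt (2 * ln 3))"
proof (intro ballI)
  fix i k assume i: "i \<in> {1..n}" and k: "k \<in> {1..l}"
  interpret prob_space M by fact
  let ?proj = "\<lambda>\<omega>. d_tr (X k i \<omega>) (Xproj k i \<omega>)"
  let ?mean = "\<lambda>\<omega>. d_tr (X k i \<omega>) (sample_mean n (X k) \<omega>)"
  note mean = expectation_d_tr_sample_mean_le[OF \<open>prob_space M\<close> \<open>\<sigma> > 0\<close> i
      gaussian[OF k] indep[OF k]]
  have le: "AE \<omega> in M. ?proj \<omega> \<le> ?mean \<omega>"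
    using through proj
  proof eventually_elim
    case (elim \<omega>)
    then have "?proj \<omega> \<le> d_tr (X k i \<omega>) (plane_rep (sample_mean n (X k) \<omega>))"
      using i k by (auto simp: is_trop_projection_def)
    then show ?case
      by (simp add: d_tr_plane_rep_right)
  qed
  have int: "integrable M ?proj"
  proof (rule Bochner_Integration.integrable_bound[OF mean(1) meas[OF k i]])
    show "AE \<omega> in M. norm (?proj \<omega>) \<le> norm (?mean \<omega>)"
      using le by eventually_elim (simp add: d_tr_nonneg)
  qed
  moreover have "expectation ?proj \<le> expectation ?mean"
    using int mean(1) le by (rule integral_mono_AE)
  ultimately show "integrable M ?proj \<and>
      expectation ?proj \<le> sqrt ((real n - 1) / real n) * (2 * \<sigma> * sqrt (2 * ln 3))"
    using mean(2) by simp
qed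

end
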